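(* Let $X'\subset X\subset\mathbb{P}_n$ be two arithmetically Cohen-Macaulay projective subschemes, both of (pure) dimension $m$. Then the characteristic sequence of $X'$ is included in that of $X$: if $(m_i)$ and $(m_i')$ are the characteristic sequences of $X$ and $X'$ respectively, then for every integer $j$, $\operatorname{card}\{i : m_i'=j\}\le\operatorname{card}\{i : m_i=j\}$.
   Context: $k$ is an algebraically closed field of characteristic $0$, $A_n=k[X_0,\dots,X_n]$. A projective subscheme $X\subset\mathbb{P}_n$ is given by its saturated homogeneous ideal $I_X$; $A_X=A_n/I_X$ and $\phi_X(l)=\dim_k A_X(l)$. $B[a](l)=B(a+l)$ denotes the shift of a graded module. $X$ of dimension $m$ is arithmetically Cohen-Macaulay (ACM) if $A_X$ admits a regular sequence of $m+1$ homogeneous polynomials. Characteristic sequence: if $X$ is nonempty ACM of pure dimension $m$ and degree $d$, and $Y_0,\dots,Y_m$ are linear forms forming a regular sequence for $A_X$, then with $R_m=k[Y_0,\dots,Y_m]$ one has $A_X\simeq\bigoplus_{i=0}^{d-1}R_m[-m_i]$ as graded $R_m$-modules with $0=m_0\le\dots\le m_{d-1}$; the sequence $(m_i)$ depends only on $\phi_X$. *)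

theory Defs
  imports
    "HOL-Algebra.QuotRing"
    "HOL-Algebra.Module"
    "HOL-Library.Poly_Mapping"
    "HOL-Computational_Algebra.Polynomial"
begin

section \<open>The polynomial rings \<open>k[X\<^sub>0,\<dots>,X\<^sub>n]\<close>\<close>

text \<open>A polynomial is a finitely supported map from exponent vectors to coefficients; the
  class instances of \<open>Poly_Mapping\<close> make \<open>*\<close> the convolution product.\<close>

type_synonym 'k mpoly = "(nat \<Rightarrow>\<^sub>0 nat) \<Rightarrow>\<^sub>0 'k"

definition var :: "nat \<Rightarrow> 'k::field mpoly" where
  "var i = Poly_Mapping.single (Poly_Mapping.single i 1) 1"

definition total_degree :: "(nat \<Rightarrow>\<^sub>0 nat) \<Rightarrow> nat" where
  "total_degree t = (\<Sum>i\<in>Poly_Mapping.keys t. Poly_Mapping.lookup t i)"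

definition poly_ring :: "nat \<Rightarrow> 'k::field mpoly ring" where
  "poly_ring n =
    \<lparr>carrier = {f. \<forall>t\<in>Poly_Mapping.keys f. Poly_Mapping.keys t \<subseteq> {..n}},
     monoid.mult = (*), one = 1, zero = 0, add = (+)\<rparr>"

lemma cring_poly_ring: "cring (poly_ring n :: 'k::field mpoly ring)"
proof -
  let ?C = "carrier (poly_ring n :: 'k mpoly ring)"
  have C: "?C = {f. \<forall>t\<in>Poly_Mapping.keys f. Poly_Mapping.keys t \<subseteq> {..n}}"
    by (simp add: poly_ring_def)
  have add_closed: "f + g \<in> ?C" if "f \<in> ?C" "g \<in> ?C" for f g :: "'k mpoly"
  proof -
    have "Poly_Mapping.keys t \<subseteq> {..n}" if t: "t \<in> Poly_Mapping.keys (f + g)" for t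
      using subsetD[OF Poly_Mapping.keys_add t] \<open>f \<in> ?C\<close> \<open>g \<in> ?C\<close> unfolding C by auto
    then show ?thesis by (simp add: C)
  qed
  have mult_closed: "f * g \<in> ?C" if "f \<in> ?C" "g \<in> ?C" for f g :: "'k mpoly"
  proof -
    have "Poly_Mapping.keys t \<subseteq> {..n}" if t: "t \<in> Poly_Mapping.keys (f * g)" for t
    proof -
      obtain a b where "t = a + b" "a \<in> Poly_Mapping.keys f" "b \<in> Poly_Mapping.keys g"
        using t Poly_Mapping.keys_mult[of f g] by blast
      moreover from this have "Poly_Mapping.keys a \<subseteq> {..n}" "Poly_Mapping.keys b \<subseteq> {..n}"
        using \<open>f \<in> ?C\<close> \<open>g \<in> ?C\<close> unfolding C by auto
      ultimately show ?thesis
        using Poly_Mapping.keys_add[of a b] by (simp add: order.trans)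
    qed
    then show ?thesis by (simp add: C)
  qed
  have uminus_closed: "- f \<in> ?C" if "f \<in> ?C" for f :: "'k mpoly"
    using that by (simp add: C)
  have ops: "monoid.mult (poly_ring n :: 'k mpoly ring) = (*)" "add (poly_ring n :: 'k mpoly ring) = (+)"
    "\<one>\<^bsub>poly_ring n :: 'k mpoly ring\<^esub> = 1" "\<zero>\<^bsub>poly_ring n :: 'k mpoly ring\<^esub> = 0"
    by (simp_all add: poly_ring_def)
  have units: "0 \<in> ?C" "1 \<in> ?C"
    by (simp_all add: C)
  show ?thesis
  proof (rule cringI)
    show "abelian_group (poly_ring n :: 'k mpoly ring)"
    proof (rule abelian_groupI)
      show "\<exists>y\<in>?C. y \<oplus>\<^bsub>poly_ring n\<^esub> x = \<zero>\<^bsub>poly_ring n\<^esub>" if "x \<in> ?C" for x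
        unfolding ops by (rule bexI[OF _ uminus_closed[OF that]]) simp
    qed (simp_all add: ops add_closed units ac_simps)
    show "comm_monoid (poly_ring n :: 'k mpoly ring)"
      by (rule comm_monoidI) (simp_all add: ops mult_closed units ac_simps)
  qed (simp add: ops distrib_right)
qed

text \<open>Degrees are integers because of the shifts below; the part of negative degree is \<open>{0}\<close>.\<close>

definition forms :: "nat \<Rightarrow> int \<Rightarrow> 'k::field mpoly set" where
  "forms n l =
    {f \<in> carrier (poly_ring n). \<forall>t\<in>Poly_Mapping.keys f. int (total_degree t) = l}"

definition subst_poly :: "'k::field mpoly list \<Rightarrow> 'k mpoly \<Rightarrow> 'k mpoly" where
  "subst_poly Ys f =
    (\<Sum>t\<in>Poly_Mapping.keys f. Poly_Mapping.single 0 (Poly_Mapping.lookup f t) *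
       (\<Prod>i\<in>Poly_Mapping.keys t. (Ys ! i) ^ Poly_Mapping.lookup t i))"


section \<open>Projective subschemes\<close>

definition homogeneous_ideal :: "nat \<Rightarrow> 'k::field mpoly set \<Rightarrow> bool" where
  "homogeneous_ideal n I \<longleftrightarrow> ideal I (poly_ring n) \<and>
    I = genideal (poly_ring n) {f \<in> I. \<exists>l. f \<in> forms n l}"

definition saturated_ideal :: "nat \<Rightarrow> 'k::field mpoly set \<Rightarrow> bool" where
  "saturated_ideal n I \<longleftrightarrow>
    (\<forall>f\<in>carrier (poly_ring n). (\<forall>i\<le>n. \<exists>N. var i ^ N * f \<in> I) \<longrightarrow> f \<in> I)"

text \<open>A closed subscheme of projective \<open>n\<close>-space is represented by its saturated homogeneous
  ideal; the unit ideal represents the empty subscheme, and \<open>X' \<subseteq> X\<close> means \<open>I\<^sub>X \<subseteq> I\<^sub>X\<^sub>'\<close>.\<close>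

definition projective_subscheme :: "nat \<Rightarrow> 'k::field mpoly set \<Rightarrow> bool" where
  "projective_subscheme n I \<longleftrightarrow> homogeneous_ideal n I \<and> saturated_ideal n I"

definition coord_ring :: "nat \<Rightarrow> 'k::field mpoly set \<Rightarrow> 'k mpoly set ring" where
  "coord_ring n I = poly_ring n Quot I"

abbreviation coord_class :: "nat \<Rightarrow> 'k::field mpoly set \<Rightarrow> 'k mpoly \<Rightarrow> 'k mpoly set" where
  "coord_class n I f \<equiv> I +>\<^bsub>poly_ring n\<^esub> f"

text \<open>The points of the scheme \<open>Proj (k[X\<^sub>0,\<dots>,X\<^sub>n]/I)\<close>. They correspond to its irreducible closed
  subsets by \<open>P \<mapsto> V(P)\<close>, with inclusions reversed.\<close>

definition proj_points :: "nat \<Rightarrow> 'k::field mpoly set \<Rightarrow> 'k mpoly set set" where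
  "proj_points n I =
    {P. primeideal P (poly_ring n) \<and> homogeneous_ideal n P \<and> I \<subseteq> P \<and> (\<exists>i\<le>n. var i \<notin> P)}"

definition chain_lengths :: "'a set set \<Rightarrow> nat set" where
  "chain_lengths S = {l. \<exists>c. (\<forall>i\<le>l. c i \<in> S) \<and> (\<forall>i<l. c i \<subset> c (Suc i))}"

text \<open>Krull dimension of the topological space underlying \<open>X\<close>; no natural number is the
  dimension of the empty subscheme.\<close>

definition has_dimension :: "nat \<Rightarrow> 'k::field mpoly set \<Rightarrow> nat \<Rightarrow> bool" where
  "has_dimension n I m \<longleftrightarrow> m \<in> chain_lengths (proj_points n I) \<and>
    (\<forall>l\<in>chain_lengths (proj_points n I). l \<le> m)"

text \<open>The irreducible components of \<open>X\<close> are the \<open>V(P)\<close> with \<open>P\<close> minimal among its points.\<close>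

definition has_pure_dimension :: "nat \<Rightarrow> 'k::field mpoly set \<Rightarrow> nat \<Rightarrow> bool" where
  "has_pure_dimension n I m \<longleftrightarrow> has_dimension n I m \<and>
    (\<forall>P\<in>proj_points n I. (\<forall>Q\<in>proj_points n I. Q \<subseteq> P \<longrightarrow> Q = P) \<longrightarrow> has_dimension n P m)"


section \<open>Arithmetically Cohen-Macaulay subschemes\<close>

definition regular_sequence :: "('a, 'b) ring_scheme \<Rightarrow> 'a list \<Rightarrow> bool" where
  "regular_sequence R xs \<longleftrightarrow> set xs \<subseteq> carrier R \<and>
    (\<forall>i<length xs. \<forall>a\<in>carrier R.
       xs ! i \<otimes>\<^bsub>R\<^esub> a \<in> genideal R (set (take i xs)) \<longrightarrow> a \<in> genideal R (set (take i xs))) \<and>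
    genideal R (set xs) \<noteq> carrier R"

definition regular_for :: "nat \<Rightarrow> 'k::field mpoly set \<Rightarrow> 'k mpoly list \<Rightarrow> bool" where
  "regular_for n I Fs \<longleftrightarrow> set Fs \<subseteq> carrier (poly_ring n) \<and>
    regular_sequence (coord_ring n I) (map (coord_class n I) Fs)"

definition ACM :: "nat \<Rightarrow> 'k::field mpoly set \<Rightarrow> bool" where
  "ACM n I \<longleftrightarrow> (\<exists>m Fs. has_dimension n I m \<and> length Fs = m + 1 \<and>
    (\<forall>F\<in>set Fs. \<exists>l. F \<in> forms n l) \<and> regular_for n I Fs)"


section \<open>Graded modules\<close>

text \<open>As in the library's record \<open>module\<close>, the fields \<open>mult\<close> and \<open>one\<close> of a module play no role.\<close>

record ('a, 'b) graded_module = "('a, 'b) module" +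
  part :: "int \<Rightarrow> 'b set"

definition shift_module ::
    "('a, 'b) graded_module \<Rightarrow> int \<Rightarrow> ('a, 'b) graded_module" where
  "shift_module M a = M\<lparr>part := (\<lambda>l. part M (a + l))\<rparr>"

definition direct_sum_module ::
    "('a, 'b) graded_module list \<Rightarrow> ('a, nat \<Rightarrow> 'b) graded_module" where
  "direct_sum_module Ms =
    \<lparr>carrier = (\<Pi>\<^sub>E i\<in>{..<length Ms}. carrier (Ms ! i)),
     monoid.mult = undefined, one = undefined,
     zero = (\<lambda>i\<in>{..<length Ms}. \<zero>\<^bsub>Ms ! i\<^esub>),
     add = (\<lambda>u v. \<lambda>i\<in>{..<length Ms}. u i \<oplus>\<^bsub>Ms ! i\<^esub> v i),
     module.smult = (\<lambda>r u. \<lambda>i\<in>{..<length Ms}. r \<odot>\<^bsub>Ms ! i\<^esub> u i),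
     part = (\<lambda>l. \<Pi>\<^sub>E i\<in>{..<length Ms}. part (Ms ! i) l)\<rparr>"

definition graded_module_iso ::
    "('a, 'r) ring_scheme \<Rightarrow> ('a, 'b) graded_module \<Rightarrow> ('a, 'c) graded_module \<Rightarrow> bool" where
  "graded_module_iso R M N \<longleftrightarrow> (\<exists>h. bij_betw h (carrier M) (carrier N) \<and>
    (\<forall>x\<in>carrier M. \<forall>y\<in>carrier M. h (x \<oplus>\<^bsub>M\<^esub> y) = h x \<oplus>\<^bsub>N\<^esub> h y) \<and>
    (\<forall>r\<in>carrier R. \<forall>x\<in>carrier M. h (r \<odot>\<^bsub>M\<^esub> x) = r \<odot>\<^bsub>N\<^esub> h x) \<and>
    (\<forall>l. h ` part M l = part N l))"

definition poly_module :: "nat \<Rightarrow> ('k::field mpoly, 'k mpoly) graded_module" where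
  "poly_module m = \<lparr>carrier = carrier (poly_ring m), monoid.mult = (*), one = 1, zero = 0, add = (+),
     module.smult = (*), part = forms m\<rparr>"

text \<open>\<open>A\<^sub>X\<close> as a graded module over \<open>R\<^sub>m = k[Y\<^sub>0,\<dots>,Y\<^sub>m]\<close>: the indeterminate with index \<open>i\<close> acts as
  multiplication by the linear form \<open>Ys ! i\<close>.\<close>

definition coord_module ::
    "nat \<Rightarrow> 'k::field mpoly set \<Rightarrow> 'k mpoly list \<Rightarrow> ('k mpoly, 'k mpoly set) graded_module" where
  "coord_module n I Ys =
    \<lparr>carrier = carrier (coord_ring n I),
     monoid.mult = monoid.mult (coord_ring n I), one = \<one>\<^bsub>coord_ring n I\<^esub>,
     zero = \<zero>\<^bsub>coord_ring n I\<^esub>, add = add (coord_ring n I),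
     module.smult = (\<lambda>r a. coord_class n I (subst_poly Ys r) \<otimes>\<^bsub>coord_ring n I\<^esub> a),
     part = (\<lambda>l. coord_class n I ` forms n l)\<rparr>"


section \<open>Characteristic sequences\<close>

text \<open>Any choice of the linear forms is allowed: the sequence is determined by the Hilbert
  function of \<open>A\<^sub>X\<close>. Its length is the degree of \<open>X\<close>, as it is the rank of \<open>A\<^sub>X\<close> over
  \<open>R\<^sub>m\<close>.\<close>

definition characteristic_sequence ::
    "nat \<Rightarrow> 'k::field mpoly set \<Rightarrow> nat \<Rightarrow> int list \<Rightarrow> bool" where
  "characteristic_sequence n I m ms \<longleftrightarrow> ms \<noteq> [] \<and> ms ! 0 = 0 \<and> sorted ms \<and>
    (\<exists>Ys. length Ys = m + 1 \<and> set Ys \<subseteq> forms n 1 \<and> regular_for n I Ys \<and>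
      graded_module_iso (poly_ring m) (coord_module n I Ys)
        (direct_sum_module (map (\<lambda>a. shift_module (poly_module m) (- a)) ms)))"

end

theory Submission
  imports Defs
begin

text \<open>Let \<open>b\<close> and \<open>b'\<close> be homogeneous bases of \<open>A\<^sub>X\<close> over \<open>k[Y]\<close> and of \<open>A\<^sub>X\<^sub>'\<close> over \<open>k[Y']\<close>, and
  put \<open>Z = Y + cY'\<close>. Generation of \<open>A\<^sub>X\<close> by \<open>b\<close> modulo \<open>Y\<close> in a given degree is an open condition
  on the linear forms, so for all but finitely many \<open>c\<close> the families \<open>b\<close> and \<open>b'\<close> still generate
  modulo \<open>Z\<close> in all degrees up to \<open>j\<close>. Hence in degree \<open>j\<close> the space \<open>A\<^sub>X\<^sub>'\<close> is spanned by the
  monomials in \<open>Z\<close> times those \<open>b'\<^sub>s\<close> with \<open>m'\<^sub>s \<noteq> j\<close>, together with the \<open>b\<^sub>s\<close> with \<open>m\<^sub>s = j\<close>.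
  Comparing with its basis of monomials in \<open>Y'\<close> times \<open>b'\<^sub>s\<close> gives the inequality.\<close>

section \<open>Linear algebra\<close>

context vector_space
begin

text \<open>Equal vectors at two indices would satisfy the relation with coefficients 1 and -1.
  Injectivity is recorded because the later counts concern index sets, while
  \<open>independent\<close> speaks of sets of vectors.\<close>

lemma independent_family:
  assumes "finite S"
    and zero: "\<And>u s. (\<Sum>s\<in>S. u s *s x s) = 0 \<Longrightarrow> s \<in> S \<Longrightarrow> u s = 0"
  shows "inj_on x S" "independent (x ` S)"
proof -
  show inj: "inj_on x S"
  proof (rule inj_onI, rule ccontr)
    fix s t assume st: "s \<in> S" "t \<in> S" "x s = x t" "s \<noteq> t"
    define u :: "'c \<Rightarrow> 'a" where "u r = (if r = s then 1 else if r = t then - 1 else 0)" for r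
    have "(\<Sum>r\<in>S. u r *s x r) = (\<Sum>r\<in>{s, t}. u r *s x r)"
      using \<open>finite S\<close> st by (intro sum.mono_neutral_right) (auto simp: u_def)
    also have "\<dots> = 0" using st by (simp add: u_def)
    finally have "u s = 0" using st(1) by (rule zero)
    then show False by (simp add: u_def)
  qed
  show "independent (x ` S)"
  proof (rule independent_if_scalars_zero)
    fix f v assume sum0: "(\<Sum>v\<in>x ` S. f v *s v) = 0" and "v \<in> x ` S"
    then obtain s where "s \<in> S" "v = x s" by blast
    moreover have "(\<Sum>s\<in>S. f (x s) *s x s) = 0"
      using sum0 by (simp add: sum.reindex[OF inj])
    ultimately show "f v = 0" using zero[of "\<lambda>s. f (x s)" s] by simp
  qed (use \<open>finite S\<close> in simp)
qed

text \<open>Applying \<open>\<phi>\<close> to a relation and subtracting \<open>t\<close> times that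
  relation removes \<open>x t\<close> and leaves a shorter one with coefficients
  \<open>u s * (s - t)\<close>. Each eigenvector is indexed by its own eigenvalue, so distinctness
  of the eigenvalues is built in.\<close>

lemma eigenvectors_independent:
  assumes lin: "Vector_Spaces.linear scale scale \<phi>" and "finite S"
    and "\<And>s. s \<in> S \<Longrightarrow> x s \<noteq> 0" and "\<And>s. s \<in> S \<Longrightarrow> \<phi> (x s) = s *s x s"
    and "(\<Sum>s\<in>S. u s *s x s) = 0" and "s \<in> S"
  shows "u s = 0"
  using assms(2-)
proof (induction S arbitrary: u s rule: finite_induct)
  case (insert t S)
  interpret \<phi>: Vector_Spaces.linear scale scale \<phi> by (rule lin)
  have sum0: "u t *s x t + (\<Sum>s\<in>S. u s *s x s) = 0"
    using insert by simp
  have "(\<Sum>s\<in>S. u s *s (s *s x s)) = (\<Sum>s\<in>S. \<phi> (u s *s x s))"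
    using insert.prems(2) by (intro sum.cong) (simp_all add: \<phi>.scale)
  then have "(u t * t) *s x t + (\<Sum>s\<in>S. u s *s (s *s x s)) = \<phi> (u t *s x t + (\<Sum>s\<in>S. u s *s x s))"
    using insert.prems(2) by (simp add: \<phi>.add \<phi>.scale \<phi>.sum)
  also have "\<dots> = t *s (u t *s x t + (\<Sum>s\<in>S. u s *s x s))"
    using sum0 by simp
  finally have "(\<Sum>s\<in>S. u s *s (s *s x s)) = (\<Sum>s\<in>S. t *s (u s *s x s))"
    by (simp add: scale_right_distrib scale_sum_right mult.commute)
  then have "(\<Sum>s\<in>S. (u s * (s - t)) *s x s) = 0"
    by (simp add: sum_subtractf right_diff_distrib scale_left_diff_distrib mult.commute)
  then have "u s * (s - t) = 0" if "s \<in> S" for s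
    using insert.IH[of "\<lambda>s. u s * (s - t)"] insert.prems(1,2) that by simp
  then have zero: "u s = 0" if "s \<in> S" for s
    using that insert.hyps(2) by auto
  then have "u t *s x t = 0" using sum0 by simp
  then have "u t = 0" using insert.prems(1) by simp
  then show ?case using zero insert.prems(4) by auto
qed simp

text \<open>The perturbed family is the image of \<open>B\<close> under \<open>id + c\<phi>\<close>, which fails to be injective on
  \<open>span B\<close> only if \<open>-1/c\<close> is an eigenvalue of \<open>\<phi>\<close> with an eigenvector in \<open>span B\<close>.\<close>

lemma finite_dependent_perturbation:
  assumes "finite B" and indep: "independent B"
  shows "finite {c. \<not> (inj_on (\<lambda>v. v + c *s w v) B \<and> independent ((\<lambda>v. v + c *s w v) ` B))}"
    (is "finite {c. \<not> ?good c}")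
proof -
  interpret p: vector_space_pair scale scale by unfold_locales
  obtain \<phi> where lin: "Vector_Spaces.linear scale scale \<phi>" and \<phi>: "\<And>v. v \<in> B \<Longrightarrow> \<phi> v = w v"
    using p.linear_independent_extend[OF indep, of w] by blast
  interpret \<phi>: Vector_Spaces.linear scale scale \<phi> by (rule lin)
  \<comment> \<open>\<open>\<phi>\<close> need not map \<open>span B\<close> into itself, so these
    are the eigenvalues that have an eigenvector inside \<open>span B\<close>, not those of an
    endomorphism of it.\<close>
  define E where "E = {s. \<exists>x\<in>span B. x \<noteq> 0 \<and> \<phi> x = s *s x}"
  define x where "x s = (SOME x. x \<in> span B \<and> x \<noteq> 0 \<and> \<phi> x = s *s x)" for s
  have x: "x s \<in> span B \<and> x s \<noteq> 0 \<and> \<phi> (x s) = s *s x s" if "s \<in> E" for s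
    unfolding x_def by (rule someI_ex) (use that in \<open>auto simp: E_def\<close>)
  \<comment> \<open>Eigenvectors for distinct eigenvalues form an independent family in
    \<open>span B\<close>, so a finite set of them has at most \<open>card B\<close> members. This
    forces \<open>E\<close> to be finite.\<close>
  have bound: "card S \<le> card B" if "finite S" "S \<subseteq> E" for S
  proof -
    have zero: "u s = 0" if "(\<Sum>s\<in>S. u s *s x s) = 0" "s \<in> S" for u s
      by (rule eigenvectors_independent[OF lin \<open>finite S\<close> _ _ that]) (use x \<open>S \<subseteq> E\<close> in auto)
    have fam: "inj_on x S" "independent (x ` S)"
      by (rule independent_family[OF \<open>finite S\<close>], erule zero, assumption)+
    have "card (x ` S) \<le> card B"
      using independent_span_bound[OF \<open>finite B\<close>, of "x ` S"] fam(2) x \<open>S \<subseteq> E\<close> by blast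
    then show ?thesis using card_image[OF fam(1)] by simp
  qed
  have "finite E"
  proof (rule ccontr)
    assume "infinite E"
    then obtain S where "S \<subseteq> E" "finite S" "card S = Suc (card B)"
      using infinite_arbitrarily_large by blast
    then show False using bound[of S] by simp
  qed
  moreover have "{c. \<not> ?good c} \<subseteq> (\<lambda>s. - inverse s) ` E"
  proof
    fix c assume bad: "c \<in> {c. \<not> ?good c}"
    let ?\<psi> = "\<lambda>v. v + c *s \<phi> v"
    have eq: "v + c *s w v = ?\<psi> v" if "v \<in> B" for v using \<phi> that by simp
    have lin\<psi>: "Vector_Spaces.linear scale scale ?\<psi>"
      by unfold_locales (simp_all add: \<phi>.add \<phi>.scale scale_right_distrib add_ac mult.commute)
    interpret \<psi>: Vector_Spaces.linear scale scale ?\<psi> by (rule lin\<psi>)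
    have "\<not> inj_on ?\<psi> (span B)"
    proof
      assume inj: "inj_on ?\<psi> (span B)"
      have "(\<lambda>v. v + c *s w v) ` B = ?\<psi> ` B"
        by (rule image_cong) (simp_all add: eq)
      then have "independent ((\<lambda>v. v + c *s w v) ` B)"
        using \<psi>.independent_injective_image[OF indep inj] by simp
      moreover have "inj_on (\<lambda>v. v + c *s w v) B"
        using inj_on_subset[OF inj span_superset] by (simp add: eq cong: inj_on_cong)
      ultimately show False using bad by blast
    qed
    then obtain y z where yz: "y \<in> span B" "z \<in> span B" "y \<noteq> z" "?\<psi> y = ?\<psi> z"
      by (auto simp: inj_on_def)
    define d where "d = y - z"
    have d: "d \<in> span B" "d \<noteq> 0" using yz by (simp_all add: d_def span_diff)
    have "?\<psi> d = 0" using \<psi>.diff[of y z] yz(4) by (simp add: d_def)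
    then have cd: "c *s \<phi> d = - d" by (simp add: add_eq_0_iff)
    then have "c \<noteq> 0" using d by auto
    then have "\<phi> d = (- inverse c) *s d"
      using arg_cong[OF cd, of "scale (inverse c)"] by simp
    then have "- inverse c \<in> E" using d by (auto simp: E_def)
    then show "c \<in> (\<lambda>s. - inverse s) ` E" by (rule rev_image_eqI) simp
  qed
  ultimately show ?thesis using finite_surj by blast
qed

text \<open>Only a basis \<open>B\<close> of \<open>V\<close>, chosen inside the possibly infinite
  set \<open>G\<close>, has to be followed. For all but finitely many \<open>c\<close> its
  perturbation stays independent; it also stays in \<open>V\<close> and has as many elements as
  \<open>B\<close>, so it spans \<open>V\<close>.\<close>

lemma finite_nonspanning_perturbation:
  assumes V: "subspace V" "V \<subseteq> span F" "finite F"
    and G: "G \<subseteq> V" "V \<subseteq> span G" and w: "\<And>v. v \<in> G \<Longrightarrow> w v \<in> V"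
  shows "finite {c. \<not> V \<subseteq> span ((\<lambda>v. v + c *s w v) ` G)}"
proof -
  obtain B where B: "B \<subseteq> G" "independent B" "G \<subseteq> span B"
    using maximal_independent_subset[of G] by blast
  have VB: "V \<subseteq> span B" using G(2) B(3) span_minimal[OF B(3)] by auto
  have finB: "finite B"
    using independent_span_bound[OF V(3) B(2)] B(1) G(1) V(2) by blast
  have "V \<subseteq> span ((\<lambda>v. v + c *s w v) ` G)"
    if inj: "inj_on (\<lambda>v. v + c *s w v) B" and ind: "independent ((\<lambda>v. v + c *s w v) ` B)" for c
  proof
    let ?B = "(\<lambda>v. v + c *s w v) ` B"
    fix y assume y: "y \<in> V"
    \<comment> \<open>A vector of \<open>V\<close> outside the span would give
      \<open>card B + 1\<close> independent vectors in \<open>V\<close>, which is spanned by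
      \<open>B\<close>.\<close>
    have "y \<in> span ?B"
    proof (rule ccontr)
      assume ny: "y \<notin> span ?B"
      then have "independent (insert y ?B)" using ind by (rule independent_insertI)
      moreover have "insert y ?B \<subseteq> V"
        using y B(1) G(1) w V(1) by (auto intro!: subspace_add subspace_scale)
      ultimately have "card (insert y ?B) \<le> card B"
        using independent_span_bound[OF finB, of "insert y ?B"] VB by (meson order_trans)
      moreover have "y \<notin> ?B" using ny span_base[of y ?B] by argo
      moreover have "card ?B = card B" "finite ?B" using finB card_image[OF inj] by simp_all
      ultimately show False using card_insert_disjoint[of ?B y] by linarith
    qed
    then show "y \<in> span ((\<lambda>v. v + c *s w v) ` G)"
      using span_mono[OF image_mono[OF B(1)]] by blast
  qed
  then show ?thesis
    by (intro finite_subset[OF _ finite_dependent_perturbation[OF finB B(2), of w]]) auto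
qed

text \<open>This is the exchange bound in the quotient by \<open>U\<close>. A projection along
  \<open>U\<close> onto a complement replaces the quotient space.\<close>

lemma card_le_of_independent_modulo:
  assumes U: "subspace U" and "finite S"
    and zero: "\<And>u s. (\<Sum>s\<in>S. u s *s x s) \<in> U \<Longrightarrow> s \<in> S \<Longrightarrow> u s = 0"
    and "finite T" and T: "x ` S \<subseteq> span (U \<union> T)"
  shows "card S \<le> card T"
proof -
  interpret p: vector_space_pair scale scale by unfold_locales
  obtain E where E: "E \<subseteq> U" "independent E" "U \<subseteq> span E"
    using maximal_independent_subset[of U] by blast
  have spanE: "span E = U" using span_subspace[OF E(1,3) U] .
  \<comment> \<open>A basis \<open>E\<close> of \<open>U\<close> is extended to the whole space;
    \<open>\<pi>\<close> kills \<open>E\<close> and fixes the added vectors, so its kernel is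
    exactly \<open>U\<close>.\<close>
  obtain B where B: "E \<subseteq> B" "independent B" "UNIV \<subseteq> span B"
    using maximal_independent_subset_extend[OF subset_UNIV E(2)] by metis
  obtain \<pi> where lin: "Vector_Spaces.linear scale scale \<pi>"
    and \<pi>: "\<And>v. v \<in> B \<Longrightarrow> \<pi> v = (if v \<in> E then 0 else v)"
    using p.linear_independent_extend[OF B(2), of "\<lambda>v. if v \<in> E then 0 else v"] by blast
  interpret \<pi>: Vector_Spaces.linear scale scale \<pi> by (rule lin)
  have \<pi>_U: "\<pi> v = 0" if "v \<in> U" for v
    by (rule \<pi>.eq_0_on_span[of E]) (use \<pi> B(1) that spanE in auto)
  have id: "\<pi> v = v" if "v \<in> span (B - E)" for v
    using that
  proof (induction rule: span_induct_alt)
    case (step c a b)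
    then show ?case using \<pi>[of a] by (simp add: \<pi>.add \<pi>.scale)
  qed simp
  have ker: "v \<in> U" if "\<pi> v = 0" for v
  proof -
    have "E \<union> (B - E) = B" using B(1) by blast
    then have "v \<in> span (E \<union> (B - E))" using B(3) by auto
    then obtain e y where "v = e + y" "e \<in> U" "y \<in> span (B - E)"
      unfolding span_Un using spanE by auto
    then show ?thesis using that \<pi>_U[of e] id[of y] by (simp add: \<pi>.add)
  qed
  have zero': "u s = 0" if "(\<Sum>s\<in>S. u s *s \<pi> (x s)) = 0" "s \<in> S" for u s
  proof (rule zero[OF ker \<open>s \<in> S\<close>])
    show "\<pi> (\<Sum>s\<in>S. u s *s x s) = 0" using that by (simp add: \<pi>.sum \<pi>.scale)
  qed
  have fam: "inj_on (\<lambda>s. \<pi> (x s)) S" "independent ((\<lambda>s. \<pi> (x s)) ` S)"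
    by (rule independent_family[OF \<open>finite S\<close>], erule zero', assumption)+
  have "\<pi> v \<in> span (\<pi> ` T)" if v: "v \<in> span (U \<union> T)" for v
  proof -
    obtain a b where "v = a + b" "a \<in> span U" "b \<in> span T"
      using v unfolding span_Un by auto
    moreover have "span U = U" using U by simp
    ultimately have "\<pi> v = \<pi> b" using \<pi>_U[of a] by (simp add: \<pi>.add)
    with \<open>b \<in> span T\<close> show ?thesis using \<pi>.span_image[of T] by auto
  qed
  then have "(\<lambda>s. \<pi> (x s)) ` S \<subseteq> span (\<pi> ` T)" using T by blast
  then have "card ((\<lambda>s. \<pi> (x s)) ` S) \<le> card (\<pi> ` T)"
    using independent_span_bound[OF _ fam(2), of "\<pi> ` T"] \<open>finite T\<close> by blast
  also have "\<dots> \<le> card T" using \<open>finite T\<close> by (rule card_image_le)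
  finally show ?thesis using card_image[OF fam(1)] by simp
qed

end

section \<open>Forms as a graded vector space\<close>

definition const_scale :: "'k::field \<Rightarrow> 'k mpoly \<Rightarrow> 'k mpoly" where
  "const_scale c f = Poly_Mapping.single 0 c * f"

interpretation mpoly: vector_space "const_scale :: 'k::field \<Rightarrow> 'k mpoly \<Rightarrow> 'k mpoly"
proof
  show "const_scale c (const_scale d f) = const_scale (c * d) f" for c d and f :: "'k mpoly"
    by (simp add: const_scale_def mult_single flip: mult.assoc)
qed (simp_all add: const_scale_def distrib_left distrib_right single_add)

lemma const_scale_mult_left: "const_scale c f * g = const_scale c (f * g)"
  by (simp add: const_scale_def mult.assoc)

lemma const_scale_mult_right: "f * const_scale c g = const_scale c (f * g)"
  by (simp add: const_scale_def mult.left_commute)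

lemma linear_mult_left: "Vector_Spaces.linear const_scale const_scale ((*) (g :: 'k::field mpoly))"
  by unfold_locales (simp_all add: distrib_left const_scale_mult_right)

section \<open>Exponent vectors of a given degree\<close>

definition exponents :: "nat \<Rightarrow> int \<Rightarrow> (nat \<Rightarrow>\<^sub>0 nat) set" where
  "exponents n l = {t. Poly_Mapping.keys t \<subseteq> {..n} \<and> int (total_degree t) = l}"

lemma total_degree_superset:
  assumes "finite A" "Poly_Mapping.keys t \<subseteq> A"
  shows "total_degree t = (\<Sum>i\<in>A. Poly_Mapping.lookup t i)"
  unfolding total_degree_def using assms
  by (intro sum.mono_neutral_left) (auto simp: in_keys_iff)

lemma total_degree_add: "total_degree (s + t) = total_degree s + total_degree t"
proof -
  let ?A = "Poly_Mapping.keys s \<union> Poly_Mapping.keys t"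
  have "total_degree (s + t) = (\<Sum>i\<in>?A. Poly_Mapping.lookup (s + t) i)"
    using Poly_Mapping.keys_add[of s t] by (intro total_degree_superset) auto
  also have "\<dots> = total_degree s + total_degree t"
    by (simp add: lookup_add sum.distrib total_degree_superset[of ?A])
  finally show ?thesis .
qed

lemma total_degree_zero [simp]: "total_degree 0 = 0"
  by (simp add: total_degree_def)

lemma total_degree_single [simp]: "total_degree (Poly_Mapping.single i k) = k"
  by (simp add: total_degree_def)

lemma lookup_le_total_degree: "Poly_Mapping.lookup t i \<le> total_degree t"
proof (cases "i \<in> Poly_Mapping.keys t")
  case True
  then show ?thesis unfolding total_degree_def by (intro member_le_sum) auto
qed (simp add: in_keys_iff)

text \<open>An exponent vector is determined by its entries at \<open>{..n}\<close>, and each of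
  them is bounded by the degree.\<close>

lemma finite_exponents [simp]: "finite (exponents n l)"
proof (rule finite_imageD)
  let ?f = "\<lambda>t. restrict (Poly_Mapping.lookup t) {..n}"
  have "?f ` exponents n l \<subseteq> (\<Pi>\<^sub>E i\<in>{..n}. {..nat l})"
  proof (rule image_subsetI)
    fix t assume t: "t \<in> exponents n l"
    have "Poly_Mapping.lookup t i \<le> nat l" for i
      using t lookup_le_total_degree[of t i] by (auto simp: exponents_def)
    then show "?f t \<in> (\<Pi>\<^sub>E i\<in>{..n}. {..nat l})" by simp
  qed
  then show "finite (?f ` exponents n l)"
    by (rule finite_subset) (simp add: finite_PiE)
  show "inj_on ?f (exponents n l)"
  proof (rule inj_onI, rule poly_mapping_eqI)
    fix s t i assume st: "s \<in> exponents n l" "t \<in> exponents n l" "?f s = ?f t"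
    show "Poly_Mapping.lookup s i = Poly_Mapping.lookup t i"
    proof (cases "i \<le> n")
      case True
      then show ?thesis using fun_cong[OF st(3), of i] by simp
    next
      case False
      then have "i \<notin> Poly_Mapping.keys s" "i \<notin> Poly_Mapping.keys t"
        using st by (auto simp: exponents_def)
      then show ?thesis by (simp add: in_keys_iff)
    qed
  qed
qed

lemma exponents_negative: "l < 0 \<Longrightarrow> exponents n l = {}"
  by (auto simp: exponents_def)

lemma exponents_zero: "exponents n 0 = {0}"
proof -
  have "t = 0" if "total_degree t = 0" for t
    using that lookup_le_total_degree[of t] by (intro poly_mapping_eqI) simp
  then show ?thesis by (auto simp: exponents_def)
qed

lemma exponents_add: "s \<in> exponents n k \<Longrightarrow> t \<in> exponents n l \<Longrightarrow> s + t \<in> exponents n (k + l)"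
  using Poly_Mapping.keys_add[of s t] by (auto simp: exponents_def total_degree_add)

lemma exponents_diff_single:
  assumes "t \<in> exponents n l" "i \<in> Poly_Mapping.keys t"
  obtains s where "t = Poly_Mapping.single i 1 + s" "s \<in> exponents n (l - 1)"
proof
  let ?s = "t - Poly_Mapping.single i 1"
  show t: "t = Poly_Mapping.single i 1 + ?s"
    using assms(2) by (intro poly_mapping_eqI) (auto simp: lookup_add lookup_minus lookup_single when_def in_keys_iff)
  have "Poly_Mapping.keys ?s \<subseteq> Poly_Mapping.keys t"
    by (auto simp: in_keys_iff lookup_minus)
  moreover have "total_degree t = 1 + total_degree ?s"
    by (subst t) (simp add: total_degree_add)
  ultimately show "?s \<in> exponents n (l - 1)"
    using assms(1) by (auto simp: exponents_def)
qed

lemma carrier_poly_ring: "carrier (poly_ring n) = {f. \<forall>t\<in>Poly_Mapping.keys f. Poly_Mapping.keys t \<subseteq> {..n}}"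
  by (simp add: poly_ring_def)

lemma poly_ring_ops [simp]:
  "monoid.mult (poly_ring n) = (*)" "add (poly_ring n) = (+)"
  "\<one>\<^bsub>poly_ring n\<^esub> = 1" "\<zero>\<^bsub>poly_ring n\<^esub> = 0"
  by (simp_all add: poly_ring_def)

lemma forms_iff: "f \<in> forms n l \<longleftrightarrow> Poly_Mapping.keys f \<subseteq> exponents n l"
  by (auto simp: forms_def carrier_poly_ring exponents_def)

lemma forms_in_carrier: "f \<in> forms n l \<Longrightarrow> f \<in> carrier (poly_ring n)"
  by (simp add: forms_def)

lemma forms_mult: "f \<in> forms n k \<Longrightarrow> g \<in> forms n l \<Longrightarrow> f * g \<in> forms n (k + l)"
  unfolding forms_iff
proof
  fix t assume *: "Poly_Mapping.keys f \<subseteq> exponents n k" "Poly_Mapping.keys g \<subseteq> exponents n l"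
    and "t \<in> Poly_Mapping.keys (f * g)"
  then obtain a b where "t = a + b" "a \<in> Poly_Mapping.keys f" "b \<in> Poly_Mapping.keys g"
    using Poly_Mapping.keys_mult[of f g] by blast
  then show "t \<in> exponents n (k + l)" using * by (simp add: exponents_add subset_iff)
qed

lemma const_in_forms: "Poly_Mapping.single 0 c \<in> forms n 0"
  by (simp add: forms_iff exponents_zero)

lemma one_in_forms: "1 \<in> forms n 0"
  by (simp add: forms_iff exponents_zero)

lemma subspace_forms: "mpoly.subspace (forms n l)"
proof (rule mpoly.subspaceI)
  show "f + g \<in> forms n l" if "f \<in> forms n l" "g \<in> forms n l" for f g :: "'a mpoly"
    using that Poly_Mapping.keys_add[of f g] by (auto simp: forms_iff)
  show "const_scale c f \<in> forms n l" if "f \<in> forms n l" for c and f :: "'a mpoly"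
    using forms_mult[OF const_in_forms that] by (simp add: const_scale_def)
qed (simp add: forms_iff)

lemma forms_negative: "l < 0 \<Longrightarrow> forms n l = {0}"
  by (auto simp: forms_iff exponents_negative)

lemma mpoly_eq_sum:
  assumes "finite A" "Poly_Mapping.keys f \<subseteq> A"
  shows "f = (\<Sum>t\<in>A. Poly_Mapping.single t (Poly_Mapping.lookup f t))"
  using assms
  by (intro poly_mapping_eqI) (auto simp: lookup_sum lookup_single when_def in_keys_iff sum.delta)

lemma forms_subset_span: "forms n l \<subseteq> mpoly.span ((\<lambda>t. Poly_Mapping.single t 1) ` exponents n l)"
proof
  fix f :: "'a mpoly" assume "f \<in> forms n l"
  then have "f = (\<Sum>t\<in>exponents n l. Poly_Mapping.single t (Poly_Mapping.lookup f t))"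
    by (intro mpoly_eq_sum) (simp_all add: forms_iff)
  also have "\<dots> = (\<Sum>t\<in>exponents n l. const_scale (Poly_Mapping.lookup f t) (Poly_Mapping.single t 1))"
    by (simp add: const_scale_def mult_single)
  also have "\<dots> \<in> mpoly.span ((\<lambda>t. Poly_Mapping.single t 1) ` exponents n l)"
    by (intro mpoly.span_sum mpoly.span_scale mpoly.span_base) simp
  finally show "f \<in> mpoly.span ((\<lambda>t. Poly_Mapping.single t 1) ` exponents n l)" .
qed

section \<open>Evaluation of monomials and polynomials at linear forms\<close>

definition monom_at :: "(nat \<Rightarrow> 'k::field mpoly) \<Rightarrow> (nat \<Rightarrow>\<^sub>0 nat) \<Rightarrow> 'k mpoly" where
  "monom_at Z t = (\<Prod>i\<in>Poly_Mapping.keys t. Z i ^ Poly_Mapping.lookup t i)"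

lemma monom_at_superset:
  assumes "finite A" "Poly_Mapping.keys t \<subseteq> A"
  shows "monom_at Z t = (\<Prod>i\<in>A. Z i ^ Poly_Mapping.lookup t i)"
  unfolding monom_at_def using assms
  by (intro prod.mono_neutral_left) (auto simp: in_keys_iff)

lemma monom_at_add: "monom_at Z (s + t) = monom_at Z s * monom_at Z t"
proof -
  let ?A = "Poly_Mapping.keys s \<union> Poly_Mapping.keys t"
  have "monom_at Z (s + t) = (\<Prod>i\<in>?A. Z i ^ Poly_Mapping.lookup (s + t) i)"
    using Poly_Mapping.keys_add[of s t] by (intro monom_at_superset) auto
  also have "\<dots> = monom_at Z s * monom_at Z t"
    by (simp add: lookup_add power_add prod.distrib monom_at_superset[of ?A])
  finally show ?thesis .
qed

lemma monom_at_zero [simp]: "monom_at Z 0 = 1"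
  by (simp add: monom_at_def)

lemma monom_at_single [simp]: "monom_at Z (Poly_Mapping.single i 1) = Z i"
  by (simp add: monom_at_def)

lemma monom_at_in_forms:
  assumes Z: "\<And>i. i \<le> m \<Longrightarrow> Z i \<in> forms n 1" and t: "t \<in> exponents m l"
  shows "monom_at Z t \<in> forms n l"
  using t
proof (induction "nat l" arbitrary: l t)
  case 0
  then have "l = 0" by (auto simp: exponents_def)
  then show ?case using 0 by (simp add: exponents_zero one_in_forms)
next
  case (Suc d)
  then have "t \<noteq> 0" by (auto simp: exponents_def)
  then obtain i where i: "i \<in> Poly_Mapping.keys t" by fastforce
  then obtain s where s: "t = Poly_Mapping.single i 1 + s" "s \<in> exponents m (l - 1)"
    using exponents_diff_single Suc.prems by blast
  have "i \<le> m" using i Suc.prems by (auto simp: exponents_def)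
  then have "Z i * monom_at Z s \<in> forms n (1 + (l - 1))"
    using Suc s by (intro forms_mult Z) auto
  then show ?case using s by (simp add: monom_at_add flip: One_nat_def)
qed

text \<open>Summing over a common finite set such as \<open>exponents m l\<close>, instead of the
  support of \<open>f\<close>, lets different polynomials share one index set.\<close>

lemma subst_poly_superset:
  assumes "finite A" "Poly_Mapping.keys f \<subseteq> A"
  shows "subst_poly Ys f = (\<Sum>t\<in>A. const_scale (Poly_Mapping.lookup f t) (monom_at ((!) Ys) t))"
  unfolding subst_poly_def monom_at_def[symmetric] const_scale_def[symmetric] using assms
  by (intro sum.mono_neutral_left) (auto simp: in_keys_iff)

lemma ideal_poly_ringD:
  assumes "ideal I (poly_ring n)"
  shows "I \<subseteq> carrier (poly_ring n)" "mpoly.subspace I"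
    "\<And>f g. f \<in> carrier (poly_ring n) \<Longrightarrow> g \<in> I \<Longrightarrow> f * g \<in> I"
proof -
  interpret ideal I "poly_ring n" by (rule assms)
  show "I \<subseteq> carrier (poly_ring n)" using a_subset .
  show mult: "f * g \<in> I" if "f \<in> carrier (poly_ring n)" "g \<in> I" for f g
    using I_l_closed[OF that(2,1)] by simp
  show "mpoly.subspace I"
  proof (rule mpoly.subspaceI)
    show "0 \<in> I" using additive_subgroup.zero_closed[OF additive_subgroup_axioms] by simp
    show "f + g \<in> I" if "f \<in> I" "g \<in> I" for f g
      using additive_subgroup.a_closed[OF additive_subgroup_axioms that] by simp
    show "const_scale c f \<in> I" if "f \<in> I" for c f
      unfolding const_scale_def by (rule mult[OF forms_in_carrier[OF const_in_forms] that])
  qed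
qed

section \<open>Graded free bases of coordinate rings\<close>

text \<open>These pairs index the intended \<open>k\<close>-basis in degree \<open>l\<close>: the
  monomial supplies the degree that the generator lacks. Generators with \<open>ms ! s > l\<close>
  drop out, since \<open>exponents\<close> is empty in negative degree.\<close>

definition gen_index :: "nat \<Rightarrow> int list \<Rightarrow> int \<Rightarrow> (nat \<times> (nat \<Rightarrow>\<^sub>0 nat)) set" where
  "gen_index m ms l = (SIGMA s:{..<length ms}. exponents m (l - ms ! s))"

definition gen ::
    "(nat \<Rightarrow> 'k::field mpoly) \<Rightarrow> (nat \<Rightarrow> 'k mpoly) \<Rightarrow> nat \<times> (nat \<Rightarrow>\<^sub>0 nat) \<Rightarrow> 'k mpoly" where
  "gen Y b p = monom_at Y (snd p) * b (fst p)"

lemma finite_gen_index [simp]: "finite (gen_index m ms l)"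
  by (simp add: gen_index_def)

text \<open>The forms \<open>b s\<close> represent a homogeneous basis of \<open>k[X\<^sub>0,\<dots>,X\<^sub>n]/I\<close> over \<open>k[Y\<^sub>0,\<dots>,Y\<^sub>m]\<close>,
  spelled out as a statement on \<open>k\<close>-bases in every degree.\<close>

locale graded_free_basis =
  fixes n m :: nat and I :: "'k::field mpoly set" and Y :: "nat \<Rightarrow> 'k mpoly"
    and ms :: "int list" and b :: "nat \<Rightarrow> 'k mpoly"
  assumes ideal: "ideal I (poly_ring n)"
    and Y_forms: "i \<le> m \<Longrightarrow> Y i \<in> forms n 1"
    and b_forms: "s < length ms \<Longrightarrow> b s \<in> forms n (ms ! s)"
    and spanning: "forms n l \<subseteq> mpoly.span (I \<inter> forms n l \<union> gen Y b ` gen_index m ms l)"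
    and independent: "(\<Sum>p\<in>gen_index m ms l. const_scale (u p) (gen Y b p)) \<in> I \<Longrightarrow>
      p \<in> gen_index m ms l \<Longrightarrow> u p = 0"

lemma subspace_carrier: "mpoly.subspace (carrier (poly_ring n))"
proof (rule mpoly.subspaceI)
  interpret cring "poly_ring n :: 'a mpoly ring" by (rule cring_poly_ring)
  show "0 \<in> carrier (poly_ring n :: 'a mpoly ring)" using zero_closed by simp
  show "f + g \<in> carrier (poly_ring n)" if "f \<in> carrier (poly_ring n)" "g \<in> carrier (poly_ring n)"
    for f g :: "'a mpoly" using a_closed[OF that] by simp
  show "const_scale c f \<in> carrier (poly_ring n)" if "f \<in> carrier (poly_ring n)" for c and f :: "'a mpoly"
    using m_closed[OF forms_in_carrier[OF const_in_forms] that] by (simp add: const_scale_def)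
qed

lemma mult_in_carrier:
  "f \<in> carrier (poly_ring n) \<Longrightarrow> g \<in> carrier (poly_ring n) \<Longrightarrow> f * g \<in> carrier (poly_ring n)"
  for f g :: "'k::field mpoly"
  using monoid.m_closed[OF ring.is_monoid[OF cring.axioms(1)[OF cring_poly_ring]], of f n g] by simp

lemma keys_subset_exponents:
  "f \<in> carrier (poly_ring n) \<Longrightarrow> t \<in> Poly_Mapping.keys f \<Longrightarrow> t \<in> exponents n (int (total_degree t))"
  by (auto simp: carrier_poly_ring exponents_def)

lemma subst_poly_in_carrier:
  assumes Ys: "\<And>i. i \<le> m \<Longrightarrow> Ys ! i \<in> forms n 1" and r: "r \<in> carrier (poly_ring m)"
  shows "subst_poly Ys r \<in> carrier (poly_ring n)"
  unfolding subst_poly_superset[OF finite_keys order_refl]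
proof (intro mpoly.subspace_sum mpoly.subspace_scale subspace_carrier)
  fix t assume t: "t \<in> Poly_Mapping.keys r"
  show "monom_at ((!) Ys) t \<in> carrier (poly_ring n)"
    by (rule forms_in_carrier, rule monom_at_in_forms[OF Ys keys_subset_exponents[OF r t]])
qed

lemma coord_class_eq_iff:
  assumes "ideal I (poly_ring n)" "f \<in> carrier (poly_ring n)" "g \<in> carrier (poly_ring n)"
  shows "coord_class n I f = coord_class n I g \<longleftrightarrow> f - g \<in> I"
proof -
  interpret cring "poly_ring n :: 'a mpoly ring" by (rule cring_poly_ring)
  have "- g \<in> carrier (poly_ring n)" using mpoly.subspace_neg[OF subspace_carrier assms(3)] .
  then have "\<ominus>\<^bsub>poly_ring n\<^esub> g = - g" using assms(3) by (intro minus_equality) auto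
  then have "f \<ominus>\<^bsub>poly_ring n\<^esub> g = f - g" by (simp add: a_minus_def)
  then show ?thesis using quotient_eq_iff_same_a_r_cos[OF assms] by simp
qed

lemma gen_in_forms:
  assumes "\<And>i. i \<le> m \<Longrightarrow> Y i \<in> forms n 1" "\<And>s. s < length ms \<Longrightarrow> b s \<in> forms n (ms ! s)"
    and "p \<in> gen_index m ms l"
  shows "gen Y b p \<in> forms n l"
proof -
  have "gen Y b p \<in> forms n ((l - ms ! fst p) + ms ! fst p)"
    using assms unfolding gen_def
    by (intro forms_mult monom_at_in_forms[of m]) (auto simp: gen_index_def)
  then show ?thesis by simp
qed

text \<open>The \<open>b s\<close> are homogeneous preimages of the standard basis vectors under the
  given isomorphism. The coordinates of a form are then the components of its image, and two
  polynomials with equal images differ by an element of \<open>I\<close>.\<close>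

lemma graded_free_basis_of_characteristic_sequence:
  assumes I: "ideal I (poly_ring n)" and cs: "characteristic_sequence n I m ms"
  obtains Y b where "graded_free_basis n m I Y ms b"
proof -
  obtain Ys where Ys: "length Ys = m + 1" "set Ys \<subseteq> forms n 1"
    and iso: "graded_module_iso (poly_ring m) (coord_module n I Ys)
        (direct_sum_module (map (\<lambda>a. shift_module (poly_module m) (- a)) ms))"
    using cs unfolding characteristic_sequence_def by (elim conjE exE) (rule that; assumption)
  let ?M = "coord_module n I Ys"
  let ?N = "direct_sum_module (map (\<lambda>a. shift_module (poly_module m) (- a)) ms)
    :: ('a mpoly, nat \<Rightarrow> 'a mpoly) graded_module"
  let ?d = "length ms"
  let ?A = "carrier (poly_ring n) :: 'a mpoly set"
  let ?R = "carrier (poly_ring m) :: 'a mpoly set"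
  obtain h where bij: "bij_betw h (carrier ?M) (carrier ?N)"
    and add: "\<forall>x\<in>carrier ?M. \<forall>y\<in>carrier ?M. h (x \<oplus>\<^bsub>?M\<^esub> y) = h x \<oplus>\<^bsub>?N\<^esub> h y"
    and smult: "\<forall>r\<in>?R. \<forall>x\<in>carrier ?M. h (r \<odot>\<^bsub>?M\<^esub> x) = r \<odot>\<^bsub>?N\<^esub> h x"
    and part: "\<forall>l. h ` part ?M l = part ?N l"
    using iso unfolding graded_module_iso_def by (elim exE conjE) (rule that)
  interpret I: ideal I "poly_ring n" by (rule I)
  have Ys_forms: "Ys ! i \<in> forms n 1" if "i \<le> m" for i
    using that Ys by (auto simp: subset_iff)
  \<comment> \<open>Composing with the residue map allows all computations to be made with
    polynomials instead of cosets.\<close>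
  define H where "H f = h (coord_class n I f)" for f
  have class_in: "coord_class n I f \<in> carrier ?M" if "f \<in> ?A" for f
    using that by (auto simp: coord_module_def coord_ring_def FactRing_def A_RCOSETS_def')
  have N_add: "u \<oplus>\<^bsub>?N\<^esub> v = (\<lambda>i\<in>{..<?d}. u i + v i)" for u v
    by (simp add: direct_sum_module_def shift_module_def poly_module_def cong: restrict_cong)
  have N_smult: "r \<odot>\<^bsub>?N\<^esub> u = (\<lambda>i\<in>{..<?d}. r * u i)" for r u
    by (simp add: direct_sum_module_def shift_module_def poly_module_def cong: restrict_cong)
  have H_add: "H (f + g) = (\<lambda>i\<in>{..<?d}. H f i + H g i)" if "f \<in> ?A" "g \<in> ?A" for f g
    using add[rule_format, OF class_in class_in, OF that] I.a_rcos_sum[OF that]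
    by (simp add: H_def N_add) (simp add: coord_module_def coord_ring_def FactRing_def)
  have H_mult: "H (subst_poly Ys r * f) = (\<lambda>i\<in>{..<?d}. r * H f i)" if "r \<in> ?R" "f \<in> ?A" for r f
    using smult[rule_format, OF that(1) class_in[OF that(2)]]
      I.rcoset_mult_add[OF subst_poly_in_carrier[OF Ys_forms that(1)] that(2)]
    by (simp add: H_def N_smult) (simp add: coord_module_def coord_ring_def FactRing_def)
  have H_part: "H ` forms n l = (\<Pi>\<^sub>E i\<in>{..<?d}. forms m (l - ms ! i))" for l
  proof -
    have "H ` forms n l = h ` part ?M l"
      by (simp add: H_def coord_module_def image_image)
    also have "\<dots> = part ?N l" using part by simp
    also have "\<dots> = (\<Pi>\<^sub>E i\<in>{..<?d}. forms m (l - ms ! i))"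
      by (auto simp: direct_sum_module_def shift_module_def poly_module_def intro!: PiE_cong)
    finally show ?thesis .
  qed
  have H_inj: "f - g \<in> I" if "f \<in> ?A" "g \<in> ?A" "H f = H g" for f g
    using inj_onD[OF bij_betw_imp_inj_on[OF bij], of "coord_class n I f" "coord_class n I g"]
      that class_in coord_class_eq_iff[OF I that(1,2)] by (simp add: H_def)
  have zero_in: "0 \<in> ?A" "0 \<in> ?R"
    using mpoly.subspace_0[OF subspace_carrier] by blast+
  have H_zero: "H 0 = (\<lambda>i\<in>{..<?d}. 0)"
    using H_mult[OF zero_in(2) zero_in(1)] by simp
  have H_ideal: "H f = (\<lambda>i\<in>{..<?d}. 0)" if "f \<in> I" for f
  proof -
    have "coord_class n I f = coord_class n I 0"
      using that zero_in ideal_poly_ringD(1)[OF I] by (subst coord_class_eq_iff[OF I]) auto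
    then show ?thesis using H_zero by (simp add: H_def)
  qed
  \<comment> \<open>The unit vector at \<open>s\<close> is homogeneous of degree
    \<open>ms ! s\<close>: after the shift its only nonzero entry, the constant 1, has to lie in
    degree 0.\<close>
  have ex_b: "\<exists>f. f \<in> forms n (ms ! s) \<and> H f = (\<lambda>i\<in>{..<?d}. if i = s then 1 else 0)" if "s < ?d" for s
  proof -
    have "(\<lambda>i\<in>{..<?d}. if i = s then 1 else 0) \<in> (\<Pi>\<^sub>E i\<in>{..<?d}. forms m (ms ! s - ms ! i) :: 'a mpoly set)"
      by (rule restrict_PiE_iff[THEN iffD2])
        (simp add: one_in_forms mpoly.subspace_0[OF subspace_forms])
    then show ?thesis unfolding H_part[symmetric] by (elim imageE) (rule exI, rule conjI, assumption, rule sym)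
  qed
  define b where "b s = (SOME f. f \<in> forms n (ms ! s) \<and> H f = (\<lambda>i\<in>{..<?d}. if i = s then 1 else 0))" for s
  have b: "b s \<in> forms n (ms ! s)" and Hb: "H (b s) = (\<lambda>i\<in>{..<?d}. if i = s then 1 else 0)"
    if "s < ?d" for s
    using someI_ex[OF ex_b[OF that]] unfolding b_def by simp_all
  have term_in: "subst_poly Ys r * b s \<in> ?A" if "r \<in> ?R" "s < ?d" for r s
    using that by (intro mult_in_carrier subst_poly_in_carrier[OF Ys_forms] forms_in_carrier[OF b])
  \<comment> \<open>\<open>H\<close> recovers the coefficients of a combination of the
    \<open>b s\<close>. Partial sums are considered for the sake of the induction;
    \<open>p = ?d\<close> is the case used.\<close>
  have H_sum: "H (\<Sum>s<p. subst_poly Ys (r s) * b s) = (\<lambda>i\<in>{..<?d}. if i < p then r i else 0)"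
    if "\<And>s. s < ?d \<Longrightarrow> r s \<in> ?R" "p \<le> ?d" for r p
    using that(2)
  proof (induction p)
    case 0
    then show ?case by (simp add: H_zero)
  next
    case (Suc p)
    have "(\<Sum>s<p. subst_poly Ys (r s) * b s) \<in> ?A"
      using Suc.prems that(1) by (intro mpoly.subspace_sum[OF subspace_carrier] term_in) auto
    moreover have "subst_poly Ys (r p) * b p \<in> ?A"
      using Suc.prems that(1) by (intro term_in) auto
    moreover have "H (subst_poly Ys (r p) * b p) = (\<lambda>i\<in>{..<?d}. if i = p then r p else 0)"
      using Suc.prems that(1)[of p] forms_in_carrier[OF b[of p]]
      by (auto simp: H_mult Hb fun_eq_iff restrict_def)
    ultimately show ?case
      using Suc by (auto simp: H_add fun_eq_iff less_Suc_eq)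
  qed
  \<comment> \<open>This passes from coefficients in \<open>k[Y]\<close> to scalar coefficients, by
    expanding each homogeneous coefficient into monomials.\<close>
  have subst_gen: "(\<Sum>s<?d. subst_poly Ys (r s) * b s) =
      (\<Sum>p\<in>gen_index m ms l. const_scale (Poly_Mapping.lookup (r (fst p)) (snd p)) (gen ((!) Ys) b p))"
    if "\<And>s. s < ?d \<Longrightarrow> r s \<in> forms m (l - ms ! s)" for r l
  proof -
    have "(\<Sum>s<?d. subst_poly Ys (r s) * b s) = (\<Sum>s<?d. \<Sum>t\<in>exponents m (l - ms ! s).
        const_scale (Poly_Mapping.lookup (r s) t) (gen ((!) Ys) b (s, t)))"
    proof (rule sum.cong)
      fix s assume "s \<in> {..<?d}"
      then have "Poly_Mapping.keys (r s) \<subseteq> exponents m (l - ms ! s)"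
        using that[of s] by (simp add: forms_iff)
      then show "subst_poly Ys (r s) * b s = (\<Sum>t\<in>exponents m (l - ms ! s).
          const_scale (Poly_Mapping.lookup (r s) t) (gen ((!) Ys) b (s, t)))"
        by (simp add: subst_poly_superset[OF finite_exponents] sum_distrib_right
            const_scale_mult_left gen_def)
    qed simp
    then show ?thesis
      by (simp add: gen_index_def sum.Sigma case_prod_unfold)
  qed
  have "graded_free_basis n m I ((!) Ys) ms b"
  proof
    fix l
    show "forms n l \<subseteq> mpoly.span (I \<inter> forms n l \<union> gen ((!) Ys) b ` gen_index m ms l)"
    proof
      fix f :: "'a mpoly" assume f: "f \<in> forms n l"
      \<comment> \<open>The components of \<open>H f\<close> are the coefficients to try: the
        combination \<open>?g\<close> has the same image as \<open>f\<close>.\<close>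
      define r where "r = H f"
      have rPi: "r \<in> (\<Pi>\<^sub>E i\<in>{..<?d}. forms m (l - ms ! i))"
        unfolding r_def H_part[symmetric] using f by simp
      then have ext: "r \<in> extensional {..<?d}"
        by (simp add: PiE_iff)
      have r: "r s \<in> forms m (l - ms ! s)" if "s < ?d" for s
        using rPi that by (simp add: PiE_iff)
      let ?g = "\<Sum>s<?d. subst_poly Ys (r s) * b s"
      have g_eq: "?g = (\<Sum>p\<in>gen_index m ms l.
          const_scale (Poly_Mapping.lookup (r (fst p)) (snd p)) (gen ((!) Ys) b p))"
        by (rule subst_gen) (rule r)
      have g1: "?g \<in> forms n l"
        unfolding g_eq using Ys_forms b
        by (intro mpoly.subspace_sum mpoly.subspace_scale subspace_forms gen_in_forms)
      have g2: "?g \<in> mpoly.span (gen ((!) Ys) b ` gen_index m ms l)"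
        unfolding g_eq
        by (intro mpoly.span_sum mpoly.span_scale mpoly.span_base imageI)
      have "H ?g = r"
        using H_sum[of r ?d] forms_in_carrier[OF r] ext
        by (auto simp: fun_eq_iff extensional_def)
      then have "f - ?g \<in> I"
        using f g1 by (intro H_inj) (auto simp: r_def intro: forms_in_carrier)
      moreover have "f - ?g \<in> forms n l"
        using f g1 by (intro mpoly.subspace_diff subspace_forms)
      ultimately have "(f - ?g) + ?g \<in> mpoly.span (I \<inter> forms n l \<union> gen ((!) Ys) b ` gen_index m ms l)"
        using subsetD[OF mpoly.span_mono[OF Un_upper2] g2]
        by (intro mpoly.span_add[OF mpoly.span_base]) auto
      then show "f \<in> mpoly.span (I \<inter> forms n l \<union> gen ((!) Ys) b ` gen_index m ms l)" by simp
    qed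
    fix u p
    assume I0: "(\<Sum>p\<in>gen_index m ms l. const_scale (u p) (gen ((!) Ys) b p)) \<in> I"
      and p: "p \<in> gen_index m ms l"
    \<comment> \<open>The scalars that belong to one generator are collected into a polynomial
      coefficient. Since the combination lies in \<open>I\<close>, its image vanishes, and with it
      every \<open>r s\<close>.\<close>
    define r where "r s = (\<Sum>t\<in>exponents m (l - ms ! s). Poly_Mapping.single t (u (s, t)))" for s
    have lookup_r: "Poly_Mapping.lookup (r s) t = (if t \<in> exponents m (l - ms ! s) then u (s, t) else 0)"
      for s t by (simp add: r_def lookup_sum lookup_single when_def)
    have r: "r s \<in> forms m (l - ms ! s)" for s
      by (auto simp: forms_iff in_keys_iff lookup_r split: if_splits)
    have "(\<Sum>s<?d. subst_poly Ys (r s) * b s) =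
        (\<Sum>p\<in>gen_index m ms l. const_scale (u p) (gen ((!) Ys) b p))"
      unfolding subst_gen[OF r] by (intro sum.cong refl) (auto simp: gen_index_def lookup_r)
    then have "H (\<Sum>s<?d. subst_poly Ys (r s) * b s) = (\<lambda>i\<in>{..<?d}. 0)"
      using I0 by (simp add: H_ideal)
    then have "(\<lambda>i\<in>{..<?d}. if i < ?d then r i else 0) = (\<lambda>i\<in>{..<?d}. 0)"
      using H_sum[of r ?d] forms_in_carrier[OF r] by simp
    then have "r (fst p) = 0"
      using p by (auto simp: gen_index_def fun_eq_iff restrict_def split: if_splits)
    then show "u p = 0"
      using lookup_r[of "fst p" "snd p"] p by (auto simp: gen_index_def)
  qed (simp_all add: I Ys_forms b)
  then show thesis by (rule that)
qed

section \<open>Generic linear forms\<close>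

text \<open>This is the hypothesis of the graded Nakayama lemma in one degree: modulo
  \<open>I\<close> and the ideal of the \<open>Z i\<close>, every form of degree \<open>l\<close> is
  a combination of the generators of that degree.\<close>

definition generates_modulo ::
    "nat \<Rightarrow> nat \<Rightarrow> 'k::field mpoly set \<Rightarrow> (nat \<Rightarrow> 'k mpoly) \<Rightarrow> int list \<Rightarrow> (nat \<Rightarrow> 'k mpoly) \<Rightarrow> int \<Rightarrow> bool"
  where "generates_modulo n m I Z ms b l \<longleftrightarrow>
    forms n l \<subseteq> mpoly.span (I \<union> {Z i * f | i f. i \<le> m \<and> f \<in> forms n (l - 1)} \<union>
      b ` {s. s < length ms \<and> ms ! s = l})"

text \<open>A nontrivial monomial is divisible by a variable. With \<open>gen_shift\<close>, each
  basis element is therefore either one of the generators or a multiple of a linear form.\<close>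

lemma gen_index_cases:
  assumes "p \<in> gen_index m ms l"
  obtains s where "p = (s, 0)" "s < length ms" "ms ! s = l"
  | s i t where "p = (s, Poly_Mapping.single i 1 + t)" "i \<le> m" "(s, t) \<in> gen_index m ms (l - 1)"
proof -
  obtain s t where p: "p = (s, t)" "s < length ms" "t \<in> exponents m (l - ms ! s)"
    using assms by (auto simp: gen_index_def)
  show thesis
  proof (cases "t = 0")
    case True
    then show thesis using p that(1) by (simp add: exponents_def)
  next
    case False
    then obtain i where i: "i \<in> Poly_Mapping.keys t" by fastforce
    then obtain t' where t': "t = Poly_Mapping.single i 1 + t'" "t' \<in> exponents m (l - ms ! s - 1)"
      by (rule exponents_diff_single[OF p(3)])
    have "i \<le> m" using i p(3) by (auto simp: exponents_def)
    then show thesis using t' p that(2)[of s i t'] by (simp add: gen_index_def algebra_simps)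
  qed
qed

lemma gen_shift: "gen Z b (s, Poly_Mapping.single i 1 + t) = Z i * gen Z b (s, t)"
  by (simp add: gen_def monom_at_add mult.assoc del: One_nat_def)

context graded_free_basis
begin

text \<open>Modulo the \<open>Y i\<close> generation follows from \<open>spanning\<close>. Replacing
  \<open>Y i * f\<close> by \<open>(Y i + const_scale c (W i)) * f\<close> moves a spanning set of
  \<open>forms n l\<close> linearly in \<open>c\<close>, so spanning fails for finitely many
  \<open>c\<close> only.\<close>

lemma finite_nongenerating_perturbation:
  assumes W: "\<And>i. i \<le> m \<Longrightarrow> W i \<in> forms n 1"
  shows "finite {c. \<not> generates_modulo n m I (\<lambda>i. Y i + const_scale c (W i)) ms b l}"
proof -
  let ?B = "b ` {s. s < length ms \<and> ms ! s = l}"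
  let ?T = "\<lambda>c. I \<union> {(Y i + const_scale c (W i)) * f | i f. i \<le> m \<and> f \<in> forms n (l - 1)} \<union> ?B"
  \<comment> \<open>\<open>I\<close> is cut down to degree \<open>l\<close>, so that
    \<open>G\<close> lies in the finite-dimensional space \<open>forms n l\<close>.\<close>
  define G where "G = I \<inter> forms n l \<union> {Y i * f | i f. i \<le> m \<and> f \<in> forms n (l - 1)} \<union> ?B"
  have lin_mult: "Z * f \<in> forms n l" if "Z \<in> forms n 1" "f \<in> forms n (l - 1)" for Z f :: "'k mpoly"
    using forms_mult[OF that] by simp
  have G: "G \<subseteq> forms n l"
    using lin_mult Y_forms b_forms unfolding G_def by blast
  have "gen Y b p \<in> G" if "p \<in> gen_index m ms l" for p
    using that
  proof (cases rule: gen_index_cases)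
    case (1 s)
    then show ?thesis unfolding G_def by (simp add: gen_def)
  next
    case (2 s i t)
    then have "gen Y b (s, t) \<in> forms n (l - 1)" using Y_forms b_forms by (intro gen_in_forms)
    then show ?thesis using 2 unfolding G_def by (auto simp: gen_shift simp del: One_nat_def)
  qed
  then have "I \<inter> forms n l \<union> gen Y b ` gen_index m ms l \<subseteq> G"
    unfolding G_def by blast
  from mpoly.span_mono[OF this] have span: "forms n l \<subseteq> mpoly.span G"
    using spanning by (rule order_trans[rotated])
  \<comment> \<open>The direction of the perturbation has to be a function of the vector alone,
    although \<open>v\<close> may factor as \<open>Y i * f\<close> in several ways. One direction
    that serves every \<open>c\<close> is chosen; elements of \<open>I\<close> and the generators
    can stay fixed.\<close>
  have ex: "\<exists>x. x \<in> forms n l \<and> (\<forall>c. v + const_scale c x \<in> ?T c)" if v: "v \<in> G" for v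
  proof -
    consider "v \<in> I \<union> ?B" | i f where "v = Y i * f" "i \<le> m" "f \<in> forms n (l - 1)"
      using v unfolding G_def by blast
    then show ?thesis
    proof cases
      case 1
      then show ?thesis by (intro exI[of _ 0]) (auto simp: mpoly.subspace_0[OF subspace_forms])
    next
      case (2 i f)
      have "v + const_scale c (W i * f) = (Y i + const_scale c (W i)) * f" for c
        by (simp add: 2 distrib_right const_scale_mult_left)
      then have "v + const_scale c (W i * f) \<in> ?T c" for c
        using 2 by blast
      then show ?thesis using lin_mult[OF W] 2 by blast
    qed
  qed
  define w where "w v = (SOME x. x \<in> forms n l \<and> (\<forall>c. v + const_scale c x \<in> ?T c))" for v
  have w: "w v \<in> forms n l" and wT: "v + const_scale c (w v) \<in> ?T c" if "v \<in> G" for v c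
    using someI_ex[OF ex[OF that]] unfolding w_def by auto
  let ?P = "\<lambda>c. mpoly.span ((\<lambda>v. v + const_scale c (w v)) ` G)"
  have "finite {c. \<not> forms n l \<subseteq> ?P c}"
    by (rule mpoly.finite_nonspanning_perturbation[OF subspace_forms forms_subset_span _ G span w]) simp_all
  moreover have "generates_modulo n m I (\<lambda>i. Y i + const_scale c (W i)) ms b l"
    if "forms n l \<subseteq> ?P c" for c
  proof -
    have "?P c \<subseteq> mpoly.span (?T c)"
      using wT by (intro mpoly.span_mono image_subsetI)
    with that show ?thesis unfolding generates_modulo_def by (rule order_trans)
  qed
  then have "{c. \<not> generates_modulo n m I (\<lambda>i. Y i + const_scale c (W i)) ms b l} \<subseteq> {c. \<not> forms n l \<subseteq> ?P c}"
    by (intro Collect_mono impI) (erule contrapos_nn)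
  ultimately show ?thesis by (rule finite_subset[rotated])
qed

text \<open>Multiplication by \<open>Z i\<close> preserves \<open>I\<close> and adds the variable
  \<open>i\<close> to the monomial of a generating product. The resulting monomials are nontrivial,
  so generators of degree \<open>l\<close> itself never occur; the final count rests on
  this.\<close>

lemma linear_form_times_span:
  assumes Z: "\<And>i. i \<le> m \<Longrightarrow> Z i \<in> forms n 1"
    and IH: "forms n (l - 1) \<subseteq> mpoly.span (I \<union> gen Z b ` gen_index m ms (l - 1))"
    and "i \<le> m" "f \<in> forms n (l - 1)"
  shows "Z i * f \<in> mpoly.span (I \<union> gen Z b ` {p \<in> gen_index m ms l. ms ! fst p \<noteq> l})"
    (is "_ \<in> mpoly.span ?T")
proof -
  interpret lin: Vector_Spaces.linear const_scale const_scale "(*) (Z i)" by (rule linear_mult_left)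
  have "(*) (Z i) ` (I \<union> gen Z b ` gen_index m ms (l - 1)) \<subseteq> ?T"
  proof
    fix x assume "x \<in> (*) (Z i) ` (I \<union> gen Z b ` gen_index m ms (l - 1))"
    then consider g where "g \<in> I" "x = Z i * g"
      | s t where "(s, t) \<in> gen_index m ms (l - 1)" "x = Z i * gen Z b (s, t)"
      by auto
    then show "x \<in> ?T"
    proof cases
      case 1
      then show ?thesis using ideal_poly_ringD(3)[OF ideal forms_in_carrier[OF Z]] \<open>i \<le> m\<close> by simp
    next
      case 2
      then have st: "s < length ms" "t \<in> exponents m (l - 1 - ms ! s)"
        by (auto simp: gen_index_def)
      have "Poly_Mapping.single i 1 \<in> exponents m 1"
        using \<open>i \<le> m\<close> by (simp add: exponents_def)
      from exponents_add[OF this st(2)]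
      have "(s, Poly_Mapping.single i 1 + t) \<in> gen_index m ms l"
        using st(1) by (simp add: gen_index_def)
      \<comment> \<open>The exponent \<open>t\<close> has degree \<open>l - 1 - ms ! s\<close>,
        which is nonnegative.\<close>
      moreover have "ms ! s \<noteq> l" using st(2) by (auto simp: exponents_def)
      ultimately show ?thesis using 2(2) by (auto simp: gen_shift[symmetric] simp del: One_nat_def)
    qed
  qed
  then have "(*) (Z i) ` mpoly.span (I \<union> gen Z b ` gen_index m ms (l - 1)) \<subseteq> mpoly.span ?T"
    unfolding lin.span_image[symmetric] by (rule mpoly.span_mono)
  then show ?thesis using IH assms(4) by blast
qed

text \<open>This is the graded Nakayama lemma: in a multiple \<open>Z i * f\<close> the factor
  \<open>f\<close> has smaller degree and is expanded by induction.\<close>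

lemma span_of_generates_modulo:
  assumes Z: "\<And>i. i \<le> m \<Longrightarrow> Z i \<in> forms n 1"
    and generates: "\<And>k. 0 \<le> k \<Longrightarrow> k \<le> l \<Longrightarrow> generates_modulo n m I Z ms b k"
  shows "forms n l \<subseteq> mpoly.span (I \<union> gen Z b ` gen_index m ms l)"
  using generates
\<comment> \<open>The shift by one makes the base case consist of the negative degrees, where the
  only form is 0.\<close>
proof (induction "nat (l + 1)" arbitrary: l)
  case 0
  then show ?case by (simp add: forms_negative mpoly.span_zero)
next
  case (Suc d)
  then have "0 \<le> l" by simp
  let ?S = "mpoly.span (I \<union> gen Z b ` gen_index m ms l)"
  have IH: "forms n (l - 1) \<subseteq> mpoly.span (I \<union> gen Z b ` gen_index m ms (l - 1))"
    using Suc.prems Suc.hyps(2) by (intro Suc.hyps(1)) auto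
  have "Z i * f \<in> ?S" if "i \<le> m" "f \<in> forms n (l - 1)" for i f
    by (rule subsetD[OF mpoly.span_mono linear_form_times_span[OF Z IH that]]) auto
  moreover have "b s \<in> ?S" if "s < length ms" "ms ! s = l" for s
  proof (rule mpoly.span_base, rule UnI2, rule image_eqI)
    show "b s = gen Z b (s, 0)" by (simp add: gen_def)
    show "(s, 0) \<in> gen_index m ms l" using that by (simp add: gen_index_def exponents_zero)
  qed
  moreover have "I \<subseteq> ?S" using mpoly.span_superset by blast
  ultimately have "mpoly.span (I \<union> {Z i * f | i f. i \<le> m \<and> f \<in> forms n (l - 1)} \<union>
      b ` {s. s < length ms \<and> ms ! s = l}) \<subseteq> ?S"
    by (intro mpoly.span_minimal mpoly.subspace_span) blast
  then show ?case
    using Suc.prems[OF \<open>0 \<le> l\<close> order_refl] unfolding generates_modulo_def by (rule order_trans[rotated])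
qed

end

text \<open>The scalar can be moved from the linear form to the other factor. This lets one family
  \<open>Z\<close> be a perturbation of \<open>Y\<close> and, up to a nonzero scalar, of
  \<open>Y'\<close>.\<close>

lemma generates_modulo_scale:
  assumes "generates_modulo n m I (\<lambda>i. const_scale c (Z i)) ms b l"
  shows "generates_modulo n m I Z ms b l"
  unfolding generates_modulo_def
proof (rule order_trans[OF assms[unfolded generates_modulo_def] mpoly.span_mono], intro Un_mono order_refl subsetI)
  fix x assume "x \<in> {const_scale c (Z i) * f | i f. i \<le> m \<and> f \<in> forms n (l - 1)}"
  then obtain i f where "x = const_scale c (Z i) * f" "i \<le> m" "f \<in> forms n (l - 1)" by blast
  then have "x = Z i * const_scale c f" "i \<le> m" "const_scale c f \<in> forms n (l - 1)"
    by (simp_all add: const_scale_mult_left const_scale_mult_right mpoly.subspace_scale[OF subspace_forms])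
  then show "x \<in> {Z i * f | i f. i \<le> m \<and> f \<in> forms n (l - 1)}" by blast
qed

section \<open>Comparison of the two bases through common linear forms\<close>

lemma card_degrees_le:
  fixes I I' :: "'k::field mpoly set"
  assumes "infinite (UNIV :: 'k set)" and "I \<subseteq> I'"
    and B: "graded_free_basis n m I Y ms b" and B': "graded_free_basis n m I' Y' ms' b'"
  shows "card {s. s < length ms' \<and> ms' ! s = j} \<le> card {s. s < length ms \<and> ms ! s = j}"
proof -
  interpret B: graded_free_basis n m I Y ms b by (rule B)
  interpret B': graded_free_basis n m I' Y' ms' b' by (rule B')
  let ?bad = "{c. \<not> generates_modulo n m I (\<lambda>i. Y i + const_scale c (Y' i)) ms b j}"
  let ?bad' = "\<lambda>l. {c. \<not> generates_modulo n m I' (\<lambda>i. Y' i + const_scale c (Y i)) ms' b' l}"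
  \<comment> \<open>Excluding 0 permits writing \<open>Z\<close> as \<open>c\<close> times
    \<open>Y' + const_scale (inverse c) Y\<close>. The parameter on that side is
    \<open>inverse c\<close>, so the exceptional values for \<open>b'\<close> enter through their
    inverses.\<close>
  have "finite (insert 0 (?bad \<union> inverse ` (\<Union>l\<in>{0..j}. ?bad' l)))"
    using B.finite_nongenerating_perturbation[OF B'.Y_forms]
      B'.finite_nongenerating_perturbation[OF B.Y_forms] by simp
  from ex_new_if_finite[OF assms(1) this]
  obtain c where c: "c \<noteq> 0" "c \<notin> ?bad" "c \<notin> inverse ` (\<Union>l\<in>{0..j}. ?bad' l)" by blast
  define Z where "Z i = Y i + const_scale c (Y' i)" for i
  have Z: "Z i \<in> forms n 1" if "i \<le> m" for i
    unfolding Z_def using B.Y_forms[OF that] B'.Y_forms[OF that]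
    by (intro mpoly.subspace_add[OF subspace_forms] mpoly.subspace_scale[OF subspace_forms])
  have gen_j: "generates_modulo n m I Z ms b j"
    using c(2) by (simp add: Z_def[abs_def])
  have gen': "generates_modulo n m I' Z ms' b' l" if "0 \<le> l" "l \<le> j" for l
  proof (rule generates_modulo_scale)
    have "inverse c \<notin> ?bad' l"
    proof
      assume "inverse c \<in> ?bad' l"
      then have "inverse (inverse c) \<in> inverse ` (\<Union>l\<in>{0..j}. ?bad' l)"
        using that by (intro imageI UN_I[of l]) auto
      then show False using c(3) by simp
    qed
    moreover have "(\<lambda>i. Y' i + const_scale (inverse c) (Y i)) = (\<lambda>i. const_scale (inverse c) (Z i))"
      using c(1) by (simp add: Z_def mpoly.scale_right_distrib add.commute)
    ultimately show "generates_modulo n m I' (\<lambda>i. const_scale (inverse c) (Z i)) ms' b' l"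
      by simp
  qed
  let ?S = "gen_index m ms' j"
  let ?S' = "{p \<in> ?S. ms' ! fst p \<noteq> j}"
  let ?J = "{s. s < length ms \<and> ms ! s = j}"
  let ?J' = "{s. s < length ms' \<and> ms' ! s = j}"
  let ?T = "gen Z b' ` ?S' \<union> b ` ?J"
  have IH: "forms n (j - 1) \<subseteq> mpoly.span (I' \<union> gen Z b' ` gen_index m ms' (j - 1))"
    using gen' by (intro B'.span_of_generates_modulo Z) auto
  have "Z i * f \<in> mpoly.span (I' \<union> ?T)" if "i \<le> m" "f \<in> forms n (j - 1)" for i f
    by (rule subsetD[OF mpoly.span_mono B'.linear_form_times_span[OF Z IH that]]) auto
  \<comment> \<open>The inclusion \<open>I \<subseteq> I'\<close> turns generation by
    \<open>b\<close> modulo \<open>I\<close> into generation modulo \<open>I'\<close>, which makes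
    the top-degree generators of \<open>b'\<close> replaceable by those of \<open>b\<close>.\<close>
  moreover have "I \<union> b ` ?J \<subseteq> mpoly.span (I' \<union> ?T)"
    using assms(2) mpoly.span_superset[of "I' \<union> ?T"] by blast
  ultimately have "mpoly.span (I \<union> {Z i * f | i f. i \<le> m \<and> f \<in> forms n (j - 1)} \<union> b ` ?J)
      \<subseteq> mpoly.span (I' \<union> ?T)"
    by (intro mpoly.span_minimal mpoly.subspace_span) blast
  then have forms_j: "forms n j \<subseteq> mpoly.span (I' \<union> ?T)"
    using gen_j unfolding generates_modulo_def by (rule order_trans[rotated])
  \<comment> \<open>The products with monomials in \<open>Y'\<close> are independent modulo
    \<open>I'\<close>, while \<open>?T\<close> spans the same degree using monomials in
    \<open>Z\<close>.\<close>
  have "card ?S \<le> card ?T"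
  proof (rule mpoly.card_le_of_independent_modulo)
    show "mpoly.subspace I'" by (rule ideal_poly_ringD(2)[OF B'.ideal])
    show "gen Y' b' ` ?S \<subseteq> mpoly.span (I' \<union> ?T)"
      using gen_in_forms[OF B'.Y_forms B'.b_forms] by (intro order_trans[OF _ forms_j] image_subsetI)
    show "u p = 0" if "(\<Sum>p\<in>?S. const_scale (u p) (gen Y' b' p)) \<in> I'" "p \<in> ?S" for u p
      using that by (rule B'.independent)
  qed simp_all
  also have "card ?T \<le> card ?S' + card ?J"
    by (intro order_trans[OF card_Un_le] add_mono card_image_le) simp_all
  finally have "card ?S \<le> card ?S' + card ?J" .
  moreover have "card ?S = card ?S' + card (?S - ?S')"
    by (subst card_Un_disjoint[symmetric]) (auto intro: arg_cong[of _ _ card])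
  \<comment> \<open>A generator of degree \<open>j\<close> admits only the monomial 1 in degree
    \<open>j\<close>, so it contributes exactly one index.\<close>
  moreover have "?S - ?S' = (\<lambda>s. (s, 0)) ` ?J'"
    by (auto simp: gen_index_def exponents_zero)
  then have "card (?S - ?S') = card ?J'"
    by (simp add: card_image inj_on_def)
  ultimately show ?thesis by simp
qed

theorem mainTheorem3:
  fixes n m :: nat
    and I I' :: "'k::{alg_closed_field, field_char_0} mpoly set"
    and ms ms' :: "int list"
  assumes "projective_subscheme n I" and "projective_subscheme n I'"
    and "I \<subseteq> I'"
    and "ACM n I" and "ACM n I'"
    and "has_pure_dimension n I m" and "has_pure_dimension n I' m"
    and "characteristic_sequence n I m ms" and "characteristic_sequence n I' m ms'"
  shows "\<forall>j::int. card {i. i < length ms' \<and> ms' ! i = j} \<le> card {i. i < length ms \<and> ms ! i = j}"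
proof -
  have "ideal I (poly_ring n)" "ideal I' (poly_ring n)"
    using assms(1,2) by (simp_all add: projective_subscheme_def homogeneous_ideal_def)
  then obtain Y b Y' b' where "graded_free_basis n m I Y ms b" "graded_free_basis n m I' Y' ms' b'"
    using graded_free_basis_of_characteristic_sequence assms(8,9) by metis
  \<comment> \<open>Characteristic zero makes \<open>k\<close> infinite, which leaves room for the
    choice of the scalar.\<close>
  with infinite_UNIV_char_0 \<open>I \<subseteq> I'\<close> show ?thesis
    by (blast intro: card_degrees_le)
qed

end
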